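(* Let $G$ be a 2-connected $o$-heavy graph on $n\geq 3$ vertices. Suppose that for every induced subgraph of $G$ isomorphic to $Z_2$, with vertices labeled $a_1,a_2,a_3,b_1,c_1$ so that its edges are $a_1a_2,a_1a_3,a_2a_3,a_1b_1,b_1c_1$, each of the pairs $\{u,v\}=\{a_2,b_1\}$ and $\{u,v\}=\{a_3,b_1\}$ satisfies $\max\{d(u),d(v)\}\geq n/2$ or $|N(u)\cap N(v)|\geq 2$. Then $G$ is Hamiltonian.
   Context: All graphs are finite and simple; $d(x)$ and $N(x)$ denote the degree and neighborhood of $x$ in $G$. A claw is $K_{1,3}$; its degree-3 vertex is the center and the other three are end-vertices. A graph $G$ on $n\geq 3$ vertices is $o$-heavy if every induced claw of $G$ has two end-vertices $x,y$ with $d(x)+d(y)\geq n$. $Z_2$ is the graph obtained from a triangle by attaching a path of length 2 to one vertex of the triangle. *)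

theory Defs
  imports "Graph_Theory.Graph_Theory"
begin

text \<open>
  Finite simple graphs are the members of \<^locale>\<open>graph\<close>: finite symmetric digraphs without loops
  and parallel arcs, where the edge \<open>uv\<close> is represented by the two arcs \<open>(u, v)\<close> and \<open>(v, u)\<close>.
  Hence the degree of a vertex is its \<^const>\<open>out_degree\<close>, and \<open>R\<^sup>s\<close>, the symmetric closure
  of \<open>R\<close>, is the adjacency relation of the graph with edge set \<open>R\<close>.
\<close>

abbreviation deg :: "('a, 'b) pre_digraph \<Rightarrow> 'a \<Rightarrow> nat" where
  "deg G v \<equiv> out_degree G v"

definition neighborhood :: "('a, 'b) pre_digraph \<Rightarrow> 'a \<Rightarrow> 'a set" where
  "neighborhood G v = {u. v \<rightarrow>\<^bsub>G\<^esub> u}"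

definition k_connected :: "nat \<Rightarrow> ('a, 'b) pre_digraph \<Rightarrow> bool" where
  "k_connected k G \<longleftrightarrow>
     k < card (verts G) \<and>
     (\<forall>S \<subseteq> verts G. card S < k \<longrightarrow> connected (G \<restriction> (verts G - S)))"

text \<open>
  \<^const>\<open>pre_digraph.cycle\<close> also admits the closed walks \<open>u, v, u\<close> along a single edge; the bound
  on the length excludes these. The vertices of a cycle are the tails of its arcs.
\<close>

definition hamiltonian :: "('a, 'b) pre_digraph \<Rightarrow> bool" where
  "hamiltonian G \<longleftrightarrow>
     (\<exists>p. pre_digraph.cycle G p \<and> 3 \<le> length p \<and> tail G ` set p = verts G)"

definition induced_claw :: "('a, 'b) pre_digraph \<Rightarrow> 'a \<Rightarrow> 'a \<Rightarrow> 'a \<Rightarrow> 'a \<Rightarrow> bool" where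
  "induced_claw G c x y z \<longleftrightarrow>
     distinct [c, x, y, z] \<and> {c, x, y, z} \<subseteq> verts G \<and>
     arcs_ends (G \<restriction> {c, x, y, z}) = {(c, x), (c, y), (c, z)}\<^sup>s"

definition induced_Z2 :: "('a, 'b) pre_digraph \<Rightarrow> 'a \<Rightarrow> 'a \<Rightarrow> 'a \<Rightarrow> 'a \<Rightarrow> 'a \<Rightarrow> bool" where
  "induced_Z2 G a1 a2 a3 b1 c1 \<longleftrightarrow>
     distinct [a1, a2, a3, b1, c1] \<and> {a1, a2, a3, b1, c1} \<subseteq> verts G \<and>
     arcs_ends (G \<restriction> {a1, a2, a3, b1, c1}) =
       {(a1, a2), (a1, a3), (a2, a3), (a1, b1), (b1, c1)}\<^sup>s"

definition o_heavy :: "('a, 'b) pre_digraph \<Rightarrow> bool" where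
  "o_heavy G \<longleftrightarrow>
     (\<forall>c x y z. induced_claw G c x y z \<longrightarrow>
       (\<exists>u \<in> {x, y, z}. \<exists>v \<in> {x, y, z}. u \<noteq> v \<and> card (verts G) \<le> deg G u + deg G v))"

end

(*
  Call two vertices related if they are adjacent or have degree sum at least n, and call v heavy if
  2 d(v) >= n. A cycle of the relation whose vertex set S is maximal among those containing all
  heavy vertices can be turned into a cycle C of G on S by Ore's crossing argument.

  If S is not everything, 2-connectedness yields a shortest path P outside S between two vertices
  x, y of C. Rerouting C along P gives larger cycles of the relation, unless certain pairs of
  vertices on C are unrelated. At each of x and y, the claw condition shows that the two neighbours
  on C have degree sum at least n, or else the Z2 condition yields on both sides a heavy vertex that
  is separated from x (or y) by neighbours of x (or y) only. Every combination of these cases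
  produces a related pair that the rerouting has excluded.
*)

theory Submission
  imports Defs
begin

section \<open>Cycles of adjacency and of its degree-sum extension\<close>

locale simple_graph =
  fixes V :: "'a set" and E :: "'a \<Rightarrow> 'a \<Rightarrow> bool"
  assumes finite_V: "finite V"
    and E_sym: "E u v \<Longrightarrow> E v u"
    and E_irrefl: "\<not> E u u"
    and E_in_V: "E u v \<Longrightarrow> u \<in> V"
begin

abbreviation n :: nat where "n \<equiv> card V"

definition d :: "'a \<Rightarrow> nat" where "d v = card {u. E v u}"

definition heavy :: "'a \<Rightarrow> bool" where "heavy v \<longleftrightarrow> n \<le> 2 * d v"

definition R :: "'a \<Rightarrow> 'a \<Rightarrow> bool" where "R u v \<longleftrightarrow> E u v \<or> n \<le> d u + d v"

lemma E_in_V2: "E u v \<Longrightarrow> v \<in> V"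
  using E_sym E_in_V by blast

lemma R_sym: "R u v \<Longrightarrow> R v u"
  unfolding R_def using E_sym by auto

lemma E_commute: "E u v \<longleftrightarrow> E v u"
  using E_sym by blast

lemma R_commute: "R u v \<longleftrightarrow> R v u"
  using R_sym by blast

lemma E_R: "E u v \<Longrightarrow> R u v"
  unfolding R_def by auto

lemma heavy_R: "heavy u \<Longrightarrow> heavy v \<Longrightarrow> R u v"
  unfolding R_def heavy_def by auto

lemma finite_nbrs: "finite {u. E v u}"
  by (rule finite_subset[OF _ finite_V]) (auto dest: E_in_V2)

text \<open>The relation is a parameter because the same lists serve as cycles of \<open>E\<close>
  and of the larger \<open>R\<close>. The length bound excludes a single pair walked back and
  forth.\<close>

definition cyc :: "('a \<Rightarrow> 'a \<Rightarrow> bool) \<Rightarrow> 'a list \<Rightarrow> bool" where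
  "cyc Q xs \<longleftrightarrow> 3 \<le> length xs \<and> distinct xs \<and> set xs \<subseteq> V \<and> successively Q xs \<and> Q (last xs) (hd xs)"

lemma cyc_rotate: "cyc Q (xs @ ys) \<Longrightarrow> cyc Q (ys @ xs)"
  unfolding cyc_def by (cases "xs = []"; cases "ys = []") (auto simp: successively_append_iff)

lemma cyc_rev:
  assumes "\<And>u v. Q u v \<Longrightarrow> Q v u" "cyc Q xs" shows "cyc Q (rev xs)"
proof -
  have "successively (\<lambda>x y. Q y x) xs"
    using assms unfolding cyc_def by (auto intro: successively_mono)
  moreover have "xs \<noteq> []" using assms unfolding cyc_def by auto
  ultimately show ?thesis using assms unfolding cyc_def by (auto simp: last_rev hd_rev)
qed

lemma cyc_rev_Cons:
  assumes "\<And>u v. Q u v \<Longrightarrow> Q v u" "cyc Q (x # xs)" shows "cyc Q (x # rev xs)"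
  using cyc_rotate[of Q "rev xs" "[x]"] cyc_rev[OF assms] by simp

lemma cyc_iff:
  "cyc Q xs \<longleftrightarrow> 3 \<le> length xs \<and> distinct xs \<and> set xs \<subseteq> V \<and> successively Q (xs @ [hd xs])"
  unfolding cyc_def by (auto simp: successively_append_iff)

lemma cyc_E_R: "cyc E xs \<Longrightarrow> cyc R xs"
  unfolding cyc_def using E_R by (auto intro: successively_mono)

end

section \<open>Rerouting a maximal cycle along a path outside it\<close>

locale maximal_cycle = simple_graph +
  fixes S :: "'a set"
  assumes maximal: "cyc R xs \<Longrightarrow> S \<subseteq> set xs \<Longrightarrow> set xs \<subseteq> S"
    and claw_R: "\<lbrakk>E c x; E c y; E c z; x \<noteq> y; x \<noteq> z; y \<noteq> z; \<not> E x y; \<not> E x z; \<not> E y z\<rbrakk> \<Longrightarrow> R x y \<or> R x z \<or> R y z"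
begin

text \<open>Nonemptiness of \<open>P\<close> is what makes a cycle on \<open>S\<close> together with
  \<open>P\<close> strictly larger. That the ends lie in \<open>S\<close> is supplied by the cycle
  in each use.\<close>

definition link :: "('a \<Rightarrow> 'a \<Rightarrow> bool) \<Rightarrow> 'a \<Rightarrow> 'a list \<Rightarrow> 'a \<Rightarrow> bool" where
  "link Q x P t \<longleftrightarrow> P \<noteq> [] \<and> distinct P \<and> set P \<subseteq> V - S \<and> successively Q (x # P @ [t])"

lemma link_rev:
  assumes "\<And>u v. Q u v \<Longrightarrow> Q v u" "link Q x P t" shows "link Q t (rev P) x"
proof -
  have "successively (\<lambda>x y. Q y x) (x # P @ [t])"
    using assms unfolding link_def by (auto intro: successively_mono)
  then have "successively Q (rev (x # P @ [t]))" by (simp only: successively_rev)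
  then show ?thesis using assms unfolding link_def by simp
qed

lemma link_E_R: "link E x P t \<Longrightarrow> link R x P t"
  unfolding link_def using E_R by (auto intro: successively_mono)

lemma link_iff:
  "link Q x P t \<longleftrightarrow> P \<noteq> [] \<and> distinct P \<and> set P \<subseteq> V - S \<and> successively Q P \<and> Q x (hd P) \<and> Q (last P) t"
  unfolding link_def by (auto simp: successively_append_iff successively_Cons)

lemma link_hd: "link Q x P t \<Longrightarrow> hd P \<in> V - S"
  unfolding link_def using hd_in_set by blast

lemma no_larger_cycle:
  assumes "cyc R xs" "set xs = S \<union> set P" "link Q x P t" shows False
proof -
  have "hd P \<in> set P" "set P \<inter> S = {}" using assms(3) unfolding link_def by auto
  then show False using maximal[OF assms(1)] assms(2) by auto
qed

lemma no_insertion: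
  assumes "cyc R (x # B)" "set (x # B) = S" "link R x P (hd B)" shows False
proof (rule no_larger_cycle[OF _ _ assms(3)])
  show "cyc R (x # P @ B)"
    using assms unfolding cyc_def link_iff
    by (auto simp: successively_append_iff successively_Cons last_append split: if_splits)
  show "set (x # P @ B) = S \<union> set P" using assms by auto
qed

lemma cyc_R_rev_Cons: "cyc R (x # xs) \<Longrightarrow> cyc R (x # rev xs)"
  using cyc_rev_Cons[of R, OF R_sym] .

lemma cyc_E_rev_Cons: "cyc E (x # xs) \<Longrightarrow> cyc E (x # rev xs)"
  using cyc_rev_Cons[of E, OF E_sym] .

lemma no_insertion_last:
  assumes "cyc R (x # B)" "set (x # B) = S" "link R x P (last B)" shows False
proof -
  have "B \<noteq> []" using assms(1) unfolding cyc_def by auto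
  then show False
    using no_insertion[OF cyc_R_rev_Cons[OF assms(1)], of P] assms by (auto simp: hd_rev)
qed

text \<open>The claw condition is applied at \<open>x\<close> to its two cycle neighbours and the
  first vertex \<open>?w\<close> of \<open>P\<close>. If \<open>?w\<close> were related to either
  neighbour, \<open>[?w]\<close> could be inserted between consecutive vertices, so only the two
  cycle neighbours remain as a related pair. Later reroutings use this pair to jump over
  \<open>x\<close>.\<close>

lemma claw_at_attachment:
  assumes C: "cyc E (x # B)" and S: "set (x # B) = S" and L: "link E x P t"
  shows "R (last B) (hd B)"
proof (rule ccontr)
  assume N: "\<not> R (last B) (hd B)"
  let ?w = "hd P"
  have len: "2 \<le> length B" and dist: "distinct B" and E: "E x (hd B)" "E x (last B)"
    using C E_sym unfolding cyc_def by (cases B; auto simp: successively_Cons)+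
  have w: "?w \<in> V - S" "E x ?w" using L link_hd[OF L] unfolding link_iff by auto
  have ne: "hd B \<noteq> last B" using len dist
    by (cases B rule: rev_cases) (auto simp: hd_append Suc_le_length_iff split: if_splits)
  have "B \<noteq> []" using len by auto
  then have inS: "hd B \<in> S" "last B \<in> S" using S by auto
  have a: "\<not> R ?w (hd B)" using no_insertion[OF cyc_E_R[OF C] S, of "[?w]"] w E_R by (auto simp: link_iff)
  have b: "\<not> R ?w (last B)" using no_insertion_last[OF cyc_E_R[OF C] S, of "[?w]"] w E_R by (auto simp: link_iff)
  have "R (last B) (hd B) \<or> R ?w (hd B) \<or> R ?w (last B)"
  proof -
    have "?w \<noteq> hd B" "?w \<noteq> last B" using w(1) inS by auto
    moreover have "\<not> E (last B) (hd B)" "\<not> E (last B) ?w" "\<not> E (hd B) ?w"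
      using N E_R[of "last B" "hd B"] a E_R[OF E_sym[of "hd B" ?w]] b E_R[OF E_sym[of "last B" ?w]]
      by blast+
    ultimately show ?thesis
      using claw_R[of x "last B" "hd B" ?w] E w(2) ne R_commute[of ?w] by auto
  qed
  then show False using N a b by blast
qed

text \<open>The larger cycle would be \<open>x, P, t, B, A\<close>: the jump over \<open>x\<close>
  leads from \<open>B\<close> to \<open>A\<close>, and the last vertex of \<open>A\<close> is
  adjacent to \<open>x\<close>. If \<open>A\<close> or \<open>B\<close> is empty, \<open>x\<close>
  and \<open>t\<close> are consecutive and plain insertion applies.\<close>

lemma no_link_to_chain:
  assumes C: "cyc E (x # A @ t # B)" and S: "set (x # A @ t # B) = S"
    and A: "\<forall>a\<in>set A. E x a" and L: "link E x P t"
  shows False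
proof (cases "A = [] \<or> B = []")
  case True
  then show False using no_insertion[OF cyc_E_R[OF C] S link_E_R, of P]
      no_insertion_last[OF cyc_E_R[OF C] S link_E_R, of P] L by auto
next
  case False
  have r: "R (last B) (hd A)" using claw_at_attachment[OF C S L] False by simp
  have "E (last A) x" using A False E_sym by auto
  then have "R (last A) x" by (rule E_R)
  moreover have pieces: "successively R ((x # A) @ (t # B) @ [x])"
    using cyc_E_R[OF C] unfolding cyc_iff by simp
  moreover have "successively R (x # P)" "R (last (x # P)) t"
    using link_E_R[OF L] unfolding link_def by (auto simp: successively_append_iff successively_Cons)
  ultimately have "successively R ((x # P) @ (t # B) @ A @ [x])"
    using r False unfolding successively_append_iff by (simp add: successively_Cons)
  moreover have "distinct (x # P @ t # B @ A)" "set (x # P @ t # B @ A) \<subseteq> V"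
    using C L S unfolding cyc_def link_def by auto
  ultimately have "cyc R (x # P @ t # B @ A)"
    using False by (cases A) (simp_all add: cyc_iff Suc_le_eq)
  moreover have "set (x # P @ t # B @ A) = S \<union> set P" using S by auto
  ultimately show False by (rule no_larger_cycle[OF _ _ link_E_R[OF L]])
qed

text \<open>The larger cycle would be \<open>x, P, t, v, A2, B, A1\<close>: the chord leads from
  \<open>t\<close> to \<open>v\<close>, the jump over \<open>t\<close> from \<open>A2\<close> to
  \<open>B\<close>, the jump over \<open>x\<close> from \<open>B\<close> to \<open>A1\<close>, and
  the last vertex of \<open>A1\<close> is adjacent to \<open>x\<close>.\<close>

lemma no_chord_before_attachment:
  assumes C: "cyc E (x # A1 @ v # A2 @ t # B)" and S: "set (x # A1 @ v # A2 @ t # B) = S"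
    and A: "\<forall>a\<in>set A1. E x a" and L: "link E x P t"
  shows "\<not> R v t"
proof
  assume vt: "R v t"
  have B: "B \<noteq> []"
    using no_insertion_last[OF cyc_E_R[OF C] S, of P] link_E_R[OF L] by auto
  have "R (last B) (hd (A1 @ [v]))"
    using claw_at_attachment[OF C S L] B by (cases A1) simp_all
  moreover have pieces: "successively R ((x # A1) @ (v # A2) @ [t] @ B @ [x])"
    using cyc_E_R[OF C] unfolding cyc_iff by simp
  \<comment> \<open>Writing \<open>A1 @ [x]\<close> also covers empty \<open>A1\<close>: its head is
    then \<open>x\<close>, which follows \<open>B\<close> on the cycle.\<close>
  ultimately have r: "R (last B) (hd (A1 @ [x]))"
    using B by (cases A1) (auto simp: successively_append_iff successively_Cons)
  have "R (hd B) (last (v # A2))"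
  proof -
    have "cyc E (t # B @ x # A1 @ v # A2)" using cyc_rotate[of E "x # A1 @ v # A2" "t # B"] C by simp
    then have "R (last (B @ x # A1 @ v # A2)) (hd (B @ x # A1 @ v # A2))"
      by (rule claw_at_attachment[OF _ _ link_rev[of E, OF E_sym L]]) (use S in auto)
    then show ?thesis using B R_sym by simp
  qed
  then have r': "R (last (v # A2)) (hd B)" using R_sym by blast
  have "successively R (A1 @ [x])"
  proof (cases "A1 = []")
    case False
    then have "R (last A1) x" using A E_sym E_R by auto
    then show ?thesis using pieces by (auto simp: successively_append_iff successively_Cons)
  qed simp
  moreover have "successively R ((x # P) @ [t])" using link_E_R[OF L] unfolding link_def by simp
  ultimately have "successively R ((x # P) @ [t] @ (v # A2) @ B @ (A1 @ [x]))"
    using pieces r r' R_sym[OF vt] B unfolding successively_append_iff by simp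
  moreover have "distinct (x # P @ t # v # A2 @ B @ A1)" "set (x # P @ t # v # A2 @ B @ A1) \<subseteq> V"
    using C L S unfolding cyc_def link_def by auto
  ultimately have "cyc R (x # P @ t # v # A2 @ B @ A1)" unfolding cyc_iff by simp
  moreover have "set (x # P @ t # v # A2 @ B @ A1) = S \<union> set P" using S by auto
  ultimately show False by (rule no_larger_cycle[OF _ _ link_E_R[OF L]])
qed

text \<open>The larger cycle would be \<open>x, P, y, rev B1, rev A2, v, u, B2, A1\<close>.
  \<open>B1\<close> is entered at its far end, a neighbour of \<open>y\<close>, and left by the jump
  over \<open>y\<close>; the chord leads from \<open>v\<close> to \<open>u\<close>, the jump over
  \<open>x\<close> from \<open>B2\<close> to \<open>A1\<close>, and the last vertex of
  \<open>A1\<close> is adjacent to \<open>x\<close>.\<close>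

lemma no_chord_after_attachments:
  assumes C: "cyc E (x # A1 @ v # A2 @ y # B1 @ u # B2)"
    and S: "set (x # A1 @ v # A2 @ y # B1 @ u # B2) = S"
    and A: "\<forall>a\<in>set A1. E x a" and B: "\<forall>a\<in>set B1. E y a" and L: "link E x P y"
  shows "\<not> R v u"
proof
  assume vu: "R v u"
  have "R (last (u # B2)) (hd (A1 @ [v]))" using claw_at_attachment[OF C S L] by (cases A1) simp_all
  moreover have pieces: "successively R ((x # A1) @ (v # A2) @ (y # B1) @ (u # B2) @ [x])"
    using cyc_E_R[OF C] unfolding cyc_iff by simp
  ultimately have r: "R (last (u # B2)) (hd (A1 @ [x]))"
    by (cases A1) (auto simp: successively_append_iff successively_Cons)
  have "R (last (v # A2)) (hd (B1 @ [u]))"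
  proof -
    let ?D = "B1 @ u # B2 @ x # A1 @ v # A2"
    have "cyc E (y # ?D)" using cyc_rotate[of E "x # A1 @ v # A2" "y # B1 @ u # B2"] C by simp
    then have "R (last ?D) (hd ?D)"
      by (rule claw_at_attachment[OF _ _ link_rev[of E, OF E_sym L]]) (use S in auto)
    then show ?thesis by (cases B1) simp_all
  qed
  \<comment> \<open>For empty \<open>B1\<close> the last vertex of \<open>y # rev B1\<close> is
    \<open>y\<close> itself, and the pair is a cycle edge.\<close>
  then have r': "R (last (y # rev B1)) (last (v # A2))"
  proof (cases B1)
    case Nil
    have "R (last (v # A2)) y" using pieces unfolding successively_append_iff by simp
    then show ?thesis using Nil R_sym by simp
  qed (use R_sym in auto)
  have "successively R (A1 @ [x])"
  proof (cases "A1 = []")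
    case False
    then have "R (last A1) x" using A E_sym E_R by auto
    then show ?thesis using pieces by (auto simp: successively_append_iff successively_Cons)
  qed simp
  moreover have "successively R (y # rev B1)"
  proof (cases "B1 = []")
    case False
    then have "R y (last B1)" using B E_R by auto
    moreover have "successively (\<lambda>a b. R b a) B1"
      using pieces R_sym by (auto simp: successively_append_iff successively_Cons intro: successively_mono)
    ultimately show ?thesis using False by (simp add: successively_Cons hd_rev)
  qed simp
  moreover have "successively R (rev (v # A2))"
  proof -
    have "successively R (v # A2)" using pieces unfolding successively_append_iff by simp
    then show ?thesis unfolding successively_rev by (rule successively_mono) (use R_sym in auto)
  qed
  moreover have "successively R (x # P)" "R (last (x # P)) y"
    using link_E_R[OF L] unfolding link_def by (auto simp: successively_append_iff successively_Cons)
  ultimately have "successively R ((x # P) @ (y # rev B1) @ rev (v # A2) @ (u # B2) @ (A1 @ [x]))"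
    using pieces r r' vu unfolding successively_append_iff by (simp add: hd_rev last_rev del: rev.simps successively_rev)
  moreover have "distinct (x # P @ y # rev B1 @ rev A2 @ v # u # B2 @ A1)"
      "set (x # P @ y # rev B1 @ rev A2 @ v # u # B2 @ A1) \<subseteq> V"
    using C L S unfolding cyc_def link_def by auto
  ultimately have "cyc R (x # P @ y # rev B1 @ rev A2 @ v # u # B2 @ A1)"
    unfolding cyc_iff by simp
  moreover have "set (x # P @ y # rev B1 @ rev A2 @ v # u # B2 @ A1) = S \<union> set P" using S by auto
  ultimately show False by (rule no_larger_cycle[OF _ _ link_E_R[OF L]])
qed

end

section \<open>Paths into a vertex set, and missing edges along a cyclic list\<close>

context simple_graph
begin

text \<open>Induction from the far end of the walk. A vertex whose successor is in \<open>T\<close>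
  is a path by itself; otherwise it is prepended to the path of its successor, or, if it already
  lies on that path, the path is cut to start there.\<close>

lemma path_to_set:
  assumes "(\<lambda>u v. E u v \<and> v \<noteq> x)\<^sup>*\<^sup>* a b" "a \<in> V - T - {x}" "b \<in> T"
  shows "\<exists>P t. P \<noteq> [] \<and> hd P = a \<and> distinct P \<and> set P \<subseteq> V - T - {x} \<and> successively E (P @ [t])
    \<and> t \<in> T \<and> t \<noteq> x"
  using assms(1,2)
proof (induction rule: converse_rtranclp_induct)
  case base
  then show ?case using assms(3) by simp
next
  case (step a c)
  show ?case
  proof (cases "c \<in> T")
    case True
    then show ?thesis using step by (intro exI[of _ "[a]"] exI[of _ c]) auto
  next
    case False
    then obtain P t where P: "P \<noteq> []" "hd P = c" "distinct P" "set P \<subseteq> V - T - {x}"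
      "successively E (P @ [t])" "t \<in> T" "t \<noteq> x"
      using step E_in_V2 by blast
    show ?thesis
    proof (cases "a \<in> set P")
      case True
      then obtain us vs where "P = us @ a # vs" by (meson split_list)
      then show ?thesis using P
        by (intro exI[of _ "a # vs"] exI[of _ t]) (auto simp: successively_append_iff)
    next
      case False
      then show ?thesis using P step
        by (intro exI[of _ "a # P"] exI[of _ t]) (cases P, auto simp: successively_Cons)
    qed
  qed
qed

fun nonedges :: "'a list \<Rightarrow> nat" where
  "nonedges (x # y # zs) = (if E x y then 0 else 1) + nonedges (y # zs)"
| "nonedges _ = 0"

lemma nonedges_append:
  "xs \<noteq> [] \<Longrightarrow> ys \<noteq> [] \<Longrightarrow>
    nonedges (xs @ ys) = nonedges xs + nonedges ys + (if E (last xs) (hd ys) then 0 else 1)"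
proof (induction xs rule: nonedges.induct)
  case ("2_2" v)
  then show ?case by (cases ys) auto
qed auto

lemma nonedges_rev: "nonedges (rev xs) = nonedges xs"
proof (induction xs)
  case (Cons x xs)
  show ?case
  proof (cases xs)
    case (Cons y ys)
    then show ?thesis
      using nonedges_append[of "rev xs" "[x]"] Cons.IH E_commute[of x y] by (simp add: last_rev)
  qed simp
qed simp

text \<open>The quantity minimised in passing from a cycle of \<open>R\<close> to a cycle of
  \<open>E\<close>.\<close>

definition cyclic_nonedges :: "'a list \<Rightarrow> nat" where
  "cyclic_nonedges xs = nonedges xs + (if E (last xs) (hd xs) then 0 else 1)"

lemma cyclic_nonedges_rotate: "cyclic_nonedges (xs @ ys) = cyclic_nonedges (ys @ xs)"
  unfolding cyclic_nonedges_def by (cases "xs = []"; cases "ys = []") (auto simp: nonedges_append)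

text \<open>Rotation brings a missing edge to the closing position, the only one the crossing
  argument has to treat.\<close>

lemma not_cyc_E_rotation:
  assumes "cyc R xs" "\<not> cyc E xs"
  obtains zs where "cyc R zs" "set zs = set xs" "cyclic_nonedges zs = cyclic_nonedges xs"
    "\<not> E (last zs) (hd zs)"
proof (cases "E (last xs) (hd xs)")
  case True
  then have "\<not> successively E xs" using assms unfolding cyc_def by auto
  then obtain i where i: "Suc i < length xs" "\<not> E (xs ! i) (xs ! Suc i)"
    unfolding successively_conv_nth by auto
  define ys where "ys = take (Suc i) xs"
  define ws where "ws = drop (Suc i) xs"
  have xs: "xs = ys @ ws" by (simp add: ys_def ws_def)
  have ne: "ys \<noteq> []" "ws \<noteq> []" using i by (auto simp: ys_def ws_def)
  have "last ys = xs ! i" using i by (simp add: ys_def take_Suc_conv_app_nth)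
  moreover have "hd ws = xs ! Suc i" using i by (simp add: ws_def hd_drop_conv_nth)
  ultimately show ?thesis
    using that[of "ws @ ys"] assms(1) ne i cyc_rotate[of R ys ws] cyclic_nonedges_rotate[of ys ws] xs by auto
qed (use that assms in blast)

end

section \<open>Ore's crossing argument\<close>

context maximal_cycle
begin

text \<open>The insertion argument shows that the ends of the missing edge have no common neighbour
  outside \<open>S\<close>, so the degree sum forces the crossing pair of edges of Ore's theorem.\<close>

lemma crossing_edges:
  assumes C: "cyc R zs" and S: "set zs = S" and N: "\<not> E (last zs) (hd zs)"
  obtains A B where "zs = A @ B" "A \<noteq> []" "B \<noteq> []" "E (last A) (last B)" "E (hd A) (hd B)"
proof -
  let ?u = "hd zs" and ?v = "last zs" and ?m = "length zs"
  have m: "3 \<le> ?m" and dist: "distinct zs" and SV: "S \<subseteq> V" and sum: "n \<le> d ?u + d ?v"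
    using C N S unfolding cyc_def R_def by auto
  have ne: "zs \<noteq> []" using m by auto
  have nth: "zs ! 0 = ?u" "zs ! (?m - 1) = ?v" using ne by (auto simp: hd_conv_nth last_conv_nth)
  \<comment> \<open>\<open>I\<close> shifts the neighbours of \<open>?u\<close> back by one
    position, so that an index common to \<open>I\<close> and \<open>J\<close> is a crossing
    pair.\<close>
  define I where "I = {i. i < ?m - 1 \<and> E ?u (zs ! Suc i)}"
  define J where "J = {i. i < ?m - 1 \<and> E ?v (zs ! i)}"
  have finI: "finite I" "finite J" by (simp_all add: I_def J_def)
  have u: "{w. E ?u w} \<inter> S \<subseteq> (\<lambda>i. zs ! Suc i) ` I"
  proof
    fix w assume w: "w \<in> {w. E ?u w} \<inter> S"
    then obtain j where j: "j < ?m" "zs ! j = w" using S by (metis IntE in_set_conv_nth)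
    have "j \<noteq> 0" using w nth j E_irrefl by (metis IntE mem_Collect_eq)
    then obtain i where "j = Suc i" by (cases j) auto
    then show "w \<in> (\<lambda>i. zs ! Suc i) ` I" using w j by (auto simp: I_def)
  qed
  have v: "{w. E ?v w} \<inter> S \<subseteq> (\<lambda>i. zs ! i) ` J"
  proof
    fix w assume w: "w \<in> {w. E ?v w} \<inter> S"
    then obtain j where j: "j < ?m" "zs ! j = w" using S by (metis IntE in_set_conv_nth)
    have "j \<noteq> ?m - 1" using w nth j E_irrefl by (metis IntE mem_Collect_eq)
    then show "w \<in> (\<lambda>i. zs ! i) ` J" using w j by (auto simp: J_def)
  qed
  have disj: "({w. E ?u w} - S) \<inter> ({w. E ?v w} - S) = {}"
  proof (rule ccontr)
    assume "\<not> ?thesis"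
    then obtain w where w: "E ?u w" "E ?v w" "w \<notin> S" by auto
    obtain B where zs: "zs = ?u # B" using ne by (metis list.collapse)
    have "B \<noteq> []" using m arg_cong[OF zs, of length] by auto
    then have B: "zs = ?u # B" "B \<noteq> []" "last B = ?v" using zs by (fact | metis last_ConsR)+
    have "link R ?u [w] (last B)" using w B E_R E_sym E_in_V2 by (auto simp: link_iff)
    then show False using no_insertion_last[of ?u B] C S B by auto
  qed
  have "card ({w. E ?u w} - S) + card ({w. E ?v w} - S) = card (({w. E ?u w} - S) \<union> ({w. E ?v w} - S))"
    using disj finite_nbrs by (simp add: card_Un_disjoint)
  also have "\<dots> \<le> card (V - S)" using finite_V E_in_V2 by (intro card_mono) auto
  also have "\<dots> = n - card S" using SV finite_V by (simp add: card_Diff_subset finite_subset)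
  finally have "card ({w. E ?u w} - S) + card ({w. E ?v w} - S) \<le> n - card S" .
  moreover have "d a = card ({w. E a w} \<inter> S) + card ({w. E a w} - S)" for a
    unfolding d_def using card_Int_Diff[OF finite_nbrs] .
  moreover have "card S \<le> n" using SV finite_V by (rule card_mono[rotated])
  ultimately have "card S \<le> card ({w. E ?u w} \<inter> S) + card ({w. E ?v w} \<inter> S)" using sum by fastforce
  moreover have "card ({w. E ?u w} \<inter> S) \<le> card I" using u finI surj_card_le by blast
  moreover have "card ({w. E ?v w} \<inter> S) \<le> card J" using v finI surj_card_le by blast
  moreover have "card S = ?m" using S dist distinct_card by fastforce
  ultimately have ge: "?m \<le> card I + card J" by linarith
  \<comment> \<open>The sizes add up to at least \<open>?m\<close>, while both sets lie among
    \<open>?m - 1\<close> indices.\<close>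
  have "I \<inter> J \<noteq> {}"
  proof
    assume "I \<inter> J = {}"
    then have "card I + card J = card (I \<union> J)" using finI by (simp add: card_Un_disjoint)
    also have "\<dots> \<le> card {..<?m - 1}" by (intro card_mono) (auto simp: I_def J_def)
    finally show False using ge m by simp
  qed
  then obtain i where i: "i < ?m - 1" "E ?u (zs ! Suc i)" "E ?v (zs ! i)" by (auto simp: I_def J_def)
  show thesis
  proof (rule that[of "take (Suc i) zs" "drop (Suc i) zs"])
    show "E (last (take (Suc i) zs)) (last (drop (Suc i) zs))"
      using i E_sym by (simp add: take_Suc_conv_app_nth)
    show "E (hd (take (Suc i) zs)) (hd (drop (Suc i) zs))"
      using i by (simp add: hd_drop_conv_nth)
  qed (use i ne in auto)
qed

text \<open>In a cycle of \<open>R\<close> on \<open>S\<close> with fewest missing edges, suppose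
  one is missing and rotate it to the closing position. In \<open>A @ rev B\<close> both new
  junctions are edges, whereas the old closing pair was not, so the count drops.\<close>

lemma ex_E_cycle:
  assumes "cyc R xs" "set xs = S"
  obtains ys where "cyc E ys" "set ys = S"
proof -
  obtain ys where ys: "cyc R ys \<and> set ys = S"
    and min: "\<And>zs. cyc R zs \<and> set zs = S \<Longrightarrow> cyclic_nonedges ys \<le> cyclic_nonedges zs"
    using ex_has_least_nat[of "\<lambda>zs. cyc R zs \<and> set zs = S" xs cyclic_nonedges] assms by blast
  have "cyc E ys"
  proof (rule ccontr)
    assume nE: "\<not> cyc E ys"
    obtain zs where zs: "cyc R zs" "set zs = set ys" "cyclic_nonedges zs = cyclic_nonedges ys"
      "\<not> E (last zs) (hd zs)"
      using not_cyc_E_rotation[OF conjunct1[OF ys] nE] .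
    then have zs: "cyc R zs" "set zs = S" "cyclic_nonedges zs = cyclic_nonedges ys"
      "\<not> E (last zs) (hd zs)" using ys by simp_all
    obtain A B where AB: "zs = A @ B" "A \<noteq> []" "B \<noteq> []" "E (last A) (last B)" "E (hd A) (hd B)"
      using crossing_edges[OF zs(1,2,4)] .
    have "successively (\<lambda>a b. R b a) B"
      using zs(1) AB R_sym unfolding cyc_def by (auto simp: successively_append_iff intro: successively_mono)
    moreover have "R (last A) (last B)" "R (hd B) (hd A)" using AB E_R E_sym by blast+
    ultimately have "cyc R (A @ rev B)"
      using zs(1) AB unfolding cyc_def by (auto simp: successively_append_iff hd_rev last_rev)
    moreover have "set (A @ rev B) = S" using AB zs by auto
    moreover have "cyclic_nonedges (A @ rev B) < cyclic_nonedges zs"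
      using AB zs(4) E_sym[OF AB(5)] unfolding cyclic_nonedges_def
      by (auto simp: nonedges_append nonedges_rev hd_rev last_rev)
    ultimately show False using min zs(3) by force
  qed
  then show thesis using that ys by blast
qed

end

section \<open>Heavy vertices from the Z2 condition\<close>

locale maximal_cycle_Z2 = maximal_cycle +
  assumes heavy_in_S: "heavy v \<Longrightarrow> v \<in> S"
    and Z2: "\<lbrakk>E a1 a2; E a1 a3; E a2 a3; E a1 b; E b c; \<not> E a1 c; \<not> E a2 b; \<not> E a2 c; \<not> E a3 b; \<not> E a3 c\<rbrakk>
      \<Longrightarrow> heavy a2 \<or> heavy b \<or> (\<exists>z. z \<noteq> a1 \<and> E a2 z \<and> E b z)"
begin

text \<open>\<open>A\<close> is the part of the cycle that starts next to \<open>x\<close>, in either direction.\<close>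

definition reachable_heavy :: "'a \<Rightarrow> 'a list \<Rightarrow> bool" where
  "reachable_heavy x A \<longleftrightarrow> (\<exists>A1 v A2. A = A1 @ v # A2 \<and> (\<forall>a\<in>set A1. E x a) \<and> heavy v)"

lemma reachable_heavy_hd: "A \<noteq> [] \<Longrightarrow> heavy (hd A) \<Longrightarrow> reachable_heavy x A"
  unfolding reachable_heavy_def by (cases A) (auto intro!: exI[of _ "[]"])

text \<open>An edge from \<open>b\<close> to \<open>w\<close>, or to \<open>q\<close> outside
  \<open>S\<close>, would make \<open>[w]\<close> or \<open>[w, q]\<close> a link from
  \<open>x\<close> to \<open>b\<close> past a chain of neighbours of \<open>x\<close>. If
  \<open>q\<close> is on the cycle, \<open>[w]\<close> links \<open>x\<close> to \<open>q\<close>: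
  this is impossible for \<open>q\<close> in \<open>A\<close>, and for \<open>q\<close> in
  \<open>D\<close> the edge would be an excluded chord. The lemma supplies non-edges of induced
  copies of Z2 and rules out common neighbours of \<open>w\<close> and \<open>b\<close>.\<close>

lemma chain_end_nonadjacent:
  assumes C: "cyc E (x # A @ b # D)" and S: "set (x # A @ b # D) = S"
    and A: "\<forall>a\<in>set A. E x a" and w: "E x w" "w \<notin> S" and q: "E w q" "q \<noteq> x"
  shows "\<not> E b q" "\<not> E b w"
proof -
  show bw: "\<not> E b w"
    using no_link_to_chain[OF C S A, of "[w]"] w E_sym E_in_V2 by (auto simp: link_iff)
  show "\<not> E b q"
  proof
    assume bq: "E b q"
    show False
    proof (cases "q \<in> S")
      case False
      moreover have "w \<noteq> q" using q E_irrefl by blast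
      ultimately show False
        using no_link_to_chain[OF C S A, of "[w, q]"] w q E_sym[OF bq] E_in_V2 by (auto simp: link_iff)
    next
      case True
      have L: "link E x [w] q" using w q E_in_V2 by (auto simp: link_iff)
      consider "q \<in> set A" | "q = b" | "q \<in> set D" using True q S by auto
      then show False
      proof cases
        case 1
        then obtain us vs where A': "A = us @ q # vs" by (meson split_list)
        show False by (rule no_link_to_chain[of x us q "vs @ b # D", OF _ _ _ L]) (use C S A A' in auto)
      next
        case 3
        then obtain us vs where D': "D = us @ q # vs" by (meson split_list)
        have "\<not> R b q"
          by (rule no_chord_before_attachment[of x A b us q vs, OF _ _ _ L]) (use C S A D' in auto)
        then show False using bq E_R by blast
      qed (use bq E_irrefl in blast)
    qed
  qed
qed

text \<open>The Z2 consists of the triangle \<open>x, w, y\<close> and the tail \<open>b, v\<close>,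
  where \<open>v\<close> is the first non-neighbour of \<open>x\<close> along \<open>A\<close> and
  \<open>b\<close> its predecessor. As \<open>w\<close> is outside \<open>S\<close>, it is not
  heavy, and it shares only \<open>x\<close> with \<open>b\<close> as a neighbour. Hence
  \<open>b\<close> is heavy, and only neighbours of \<open>x\<close> precede it.\<close>

lemma heavy_after_triangle:
  assumes C: "cyc E (x # A @ y # B)" and S: "set (x # A @ y # B) = S"
    and w: "E x w" "w \<notin> S" "E w y" and xy: "E x y"
  shows "reachable_heavy x A"
proof -
  have L: "link E x [w] y" using w E_in_V2 by (auto simp: link_iff)
  have yx: "y \<noteq> x" using xy E_irrefl by blast
  have A: "A \<noteq> []" using no_link_to_chain[of x "[]" y B, OF _ _ _ L] C S by auto
  \<comment> \<open>If all of \<open>A\<close> were adjacent to \<open>x\<close>, its last vertex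
    could not be adjacent to \<open>y\<close>, which follows it on the cycle.\<close>
  have "\<exists>v\<in>set A. \<not> E x v"
  proof (rule ccontr)
    assume all: "\<not> ?thesis"
    obtain A' l where A': "A = A' @ [l]" using A by (cases A rule: rev_cases) auto
    have "\<not> E l y"
      by (rule chain_end_nonadjacent(1)[of x A' l "y # B" w]) (use C S A' all w yx in auto)
    then show False using C A' unfolding cyc_def by (auto simp: successively_append_iff successively_Cons)
  qed
  then obtain A1 v A2 where A1: "A = A1 @ v # A2" "\<not> E x v" "\<forall>a\<in>set A1. E x a"
    using split_list_first_prop[of A "\<lambda>v. \<not> E x v"] by auto
  have "A1 \<noteq> []" using A1 C unfolding cyc_def by (auto simp: successively_Cons)
  then obtain A0 b where A0: "A1 = A0 @ [b]" by (cases A1 rule: rev_cases) auto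
  have bv: "E b v" and xb: "E x b"
    using C A1 A0 unfolding cyc_def by (auto simp: successively_append_iff successively_Cons)
  have v: "\<not> E v y" "\<not> E v w"
    using chain_end_nonadjacent[of x A1 v "A2 @ y # B" w y] C S A1 w yx by auto
  have b: "\<not> E b w" "\<And>q. E w q \<Longrightarrow> q \<noteq> x \<Longrightarrow> \<not> E b q"
    using chain_end_nonadjacent[of x A0 b "v # A2 @ y # B" w] C S A1 A0 w yx by auto
  have "heavy w \<or> heavy b \<or> (\<exists>z. z \<noteq> x \<and> E w z \<and> E b z)"
  proof (rule Z2[of x w y b v])
    show "\<not> E w b" "\<not> E w v" "\<not> E y b" "\<not> E y v"
      using b(1) b(2)[OF w(3) yx] v E_commute[of b] E_commute[of v] by auto
  qed (use w xy xb bv A1 in auto)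
  then have "heavy b" using b w heavy_in_S by blast
  then show ?thesis unfolding reachable_heavy_def
    using A1 A0 by (intro exI[of _ A0] exI[of _ b] exI[of _ "v # A2"]) auto
qed

text \<open>The Z2 now consists of the triangle of \<open>x\<close> with its two cycle neighbours
  and the tail \<open>w, q\<close>. Again \<open>w\<close> is not heavy and shares only
  \<open>x\<close> with \<open>hd B\<close> as a neighbour.\<close>

lemma heavy_hd_of_adjacent:
  assumes C: "cyc E (x # B)" and S: "set (x # B) = S" and hl: "E (hd B) (last B)"
    and w: "E x w" "w \<notin> S" "E w q" "q \<noteq> x" "\<not> E x q"
  shows "heavy (hd B)"
proof -
  obtain b D where B: "B = b # D" using C unfolding cyc_def by (cases B) auto
  obtain l D' where B': "rev B = l # D'" using B by (cases "rev B") auto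
  have l: "last B = l" using B' B by (metis hd_rev list.sel(1))
  have xb: "E x b" "E x l" using C B l E_sym unfolding cyc_def by (auto simp: successively_Cons)
  have b: "\<not> E b w" "\<And>q. E w q \<Longrightarrow> q \<noteq> x \<Longrightarrow> \<not> E b q"
    using chain_end_nonadjacent[of x "[]" b D w] C S B w by auto
  have "cyc E (x # [] @ l # D')" "set (x # [] @ l # D') = S"
    using cyc_E_rev_Cons[OF C] B' S set_rev[of B] by auto
  then have l': "\<not> E l w" "\<not> E l q"
    using chain_end_nonadjacent[of x "[]" l D' w q] w by auto
  have "heavy b \<or> heavy w \<or> (\<exists>z. z \<noteq> x \<and> E b z \<and> E w z)"
    by (rule Z2[of x b l w q]) (use w xb hl B l b l' in auto)
  then show ?thesis using b w heavy_in_S B by auto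
qed

text \<open>If \<open>x\<close>, \<open>y\<close> and the first vertex \<open>?w\<close> of
  \<open>P\<close> form a triangle, it yields a heavy vertex in both directions. Otherwise there is
  a path \<open>x, ?w, q\<close> with \<open>x\<close> and \<open>q\<close> not adjacent: if the
  cycle neighbours of \<open>x\<close> are adjacent, both are heavy, and if not, their relation is a
  degree sum.\<close>

lemma attachment_cases:
  assumes C: "cyc E (x # A @ y # B)" and S: "set (x # A @ y # B) = S" and L: "link E x P y"
    and short: "\<And>P'. link E x P' y \<Longrightarrow> length P \<le> length P'"
  shows "n \<le> d (hd A) + d (last B) \<or> reachable_heavy x A \<and> reachable_heavy x (rev B)"
proof -
  have A: "A \<noteq> []" using no_link_to_chain[of x "[]" y B, OF _ _ _ L] C S by auto
  have rC: "cyc E (x # rev B @ y # rev A)" using cyc_E_rev_Cons[OF C] by simp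
  have rS: "set (x # rev B @ y # rev A) = S" using S by auto
  have B: "B \<noteq> []" using no_link_to_chain[of x "[]" y "rev A", OF _ _ _ L] rC rS by auto
  have yx: "y \<noteq> x" using C unfolding cyc_def by auto
  let ?w = "hd P"
  have w: "E x ?w" "?w \<notin> S" using L link_hd[OF L] unfolding link_iff by auto
  show ?thesis
  proof (cases "E x y \<and> E ?w y")
    case True
    then show ?thesis using heavy_after_triangle[OF C S w] heavy_after_triangle[OF rC rS w] by blast
  next
    case False
    \<comment> \<open>\<open>q\<close> follows \<open>?w\<close> on the link. It is \<open>y\<close>
      if \<open>P\<close> is a single vertex; otherwise an edge from \<open>x\<close> to
      \<open>q\<close> would give a shorter link.\<close>
    obtain q where q: "E ?w q" "q \<noteq> x" "\<not> E x q"
    proof (cases "tl P = []")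
      case True
      then have "P = [?w]" using L unfolding link_iff by (cases P) auto
      then have "E ?w y" using L unfolding link_iff by (metis last.simps)
      then show ?thesis using that[of y] False yx by blast
    next
      case False
      then obtain w q P' where P: "P = w # q # P'" by (cases P; cases "tl P") auto
      have "\<not> E x q"
      proof
        assume "E x q"
        then have "link E x (q # P') y" using L unfolding P link_iff by auto
        then show False using short P by force
      qed
      moreover have "q \<noteq> x" using L S unfolding P link_iff by auto
      ultimately show ?thesis using that[of q] L unfolding P link_iff by auto
    qed
    show ?thesis
    proof (cases "E (hd A) (last B)")
      case True
      have "heavy (hd A)"
        using heavy_hd_of_adjacent[OF C S _ w q] True A B by simp
      moreover have "heavy (last B)"
        using heavy_hd_of_adjacent[OF rC rS _ w q] E_sym[OF True] A B by (simp add: hd_rev last_rev)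
      ultimately show ?thesis using reachable_heavy_hd A B by (simp add: hd_rev)
    next
      case False
      have "R (last B) (hd A)" using claw_at_attachment[OF C S L] A B by simp
      then show ?thesis using False E_sym unfolding R_def by auto
    qed
  qed
qed

lemma not_both_reachable_heavy:
  assumes C: "cyc E (x # A @ y # B)" and S: "set (x # A @ y # B) = S" and L: "link E x P y"
  shows "\<not> (reachable_heavy x A \<and> reachable_heavy y B)"
proof
  assume "reachable_heavy x A \<and> reachable_heavy y B"
  then obtain A1 v A2 B1 u B2 where *: "A = A1 @ v # A2" "\<forall>a\<in>set A1. E x a" "heavy v"
      "B = B1 @ u # B2" "\<forall>a\<in>set B1. E y a" "heavy u"
    unfolding reachable_heavy_def by metis
  have "\<not> R v u"
    by (rule no_chord_after_attachments[of x A1 v A2 y B1 u B2 P]) (use C S L * in auto)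
  then show False using heavy_R * by blast
qed

text \<open>Each of \<open>x\<close> and \<open>y\<close> has either a degree sum or heavy vertices
  in both directions. Two degree sums contradict the unrelated pairs of successors and of
  predecessors. In every other combination one end has heavy vertices in both directions and the
  other in at least one, which yields a forbidden pair.\<close>

lemma no_link:
  assumes C: "cyc E (x # A @ y # B)" and S: "set (x # A @ y # B) = S" and L0: "link E x P0 y"
  shows False
proof -
  obtain P where L: "link E x P y" and short: "\<And>P'. link E x P' y \<Longrightarrow> length P \<le> length P'"
    using ex_has_least_nat[of "\<lambda>P. link E x P y" P0 length] L0 by blast
  have A: "A \<noteq> []" using no_link_to_chain[of x "[]" y B, OF _ _ _ L] C S by auto
  have rC: "cyc E (x # rev B @ y # rev A)" using cyc_E_rev_Cons[OF C] by simp
  have rS: "set (x # rev B @ y # rev A) = S" using S by auto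
  have B: "B \<noteq> []" using no_link_to_chain[of x "[]" y "rev A", OF _ _ _ L] rC rS by auto
  have yC: "cyc E (y # B @ x # A)" using cyc_rotate[of E "x # A" "y # B"] C by simp
  have yS: "set (y # B @ x # A) = S" using S by auto
  have yL: "link E y (rev P) x" by (rule link_rev[OF E_sym L])
  have x: "n \<le> d (hd A) + d (last B) \<or> reachable_heavy x A \<and> reachable_heavy x (rev B)"
    by (rule attachment_cases[OF C S L short])
  have y: "n \<le> d (hd B) + d (last A) \<or> reachable_heavy y B \<and> reachable_heavy y (rev A)"
  proof (rule attachment_cases[OF yC yS yL])
    fix Q assume "link E y Q x"
    then have "length P \<le> length (rev Q)" by (intro short link_rev[of E, OF E_sym])
    then show "length (rev P) \<le> length Q" by simp
  qed
  have n1: "\<not> (reachable_heavy x A \<and> reachable_heavy y B)" by (rule not_both_reachable_heavy[OF C S L])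
  have n2: "\<not> (reachable_heavy x (rev B) \<and> reachable_heavy y (rev A))" by (rule not_both_reachable_heavy[OF rC rS L])
  \<comment> \<open>A sum of at least \<open>n\<close> has a heavy summand, so a degree sum gives a
    heavy vertex in one direction.\<close>
  have one: "reachable_heavy z (rev X) \<or> reachable_heavy z Y"
    if "n \<le> d (hd Y) + d (last X)" "X \<noteq> []" "Y \<noteq> []" for z X Y
  proof -
    have "heavy (hd Y) \<or> heavy (last X)" using that unfolding heavy_def by auto
    then show ?thesis using that reachable_heavy_hd[of Y] reachable_heavy_hd[of "rev X"] by (auto simp: hd_rev)
  qed
  have h1: "\<not> R (hd A) (hd B)" if "cyc E (x # A @ y # B)" "set (x # A @ y # B) = S" "A \<noteq> []" "B \<noteq> []" for A B
  proof -
    obtain a A' b B' where "A = a # A'" "B = b # B'" using \<open>A \<noteq> []\<close> \<open>B \<noteq> []\<close> by (meson list.exhaust)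
    then show ?thesis using no_chord_after_attachments[of x "[]" a A' y "[]" b B' P] that L by simp
  qed
  have "\<not> R (hd A) (hd B)" "\<not> R (last B) (last A)"
    using h1[OF C S A B] h1[OF rC rS] A B by (simp_all add: hd_rev)
  \<comment> \<open>The four degrees would total at least \<open>2 * n\<close>, but the two
    unrelated pairs total less than \<open>n\<close> each.\<close>
  then have "\<not> (n \<le> d (hd A) + d (last B) \<and> n \<le> d (hd B) + d (last A))"
    unfolding R_def by linarith
  moreover have "reachable_heavy x (rev B) \<or> reachable_heavy x A" if "n \<le> d (hd A) + d (last B)"
    by (rule one) (use that A B in auto)
  moreover have "reachable_heavy y (rev A) \<or> reachable_heavy y B" if "n \<le> d (hd B) + d (last A)"
    by (rule one) (use that A B in auto)
  ultimately show False using x y n1 n2 by satx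
qed

end

section \<open>Consequences of 2-connectedness, and the spanning cycle\<close>

locale two_connected_graph = simple_graph +
  assumes n_ge_3: "3 \<le> n"
    and two_connected: "\<lbrakk>a \<in> V - {x}; b \<in> V - {x}\<rbrakk> \<Longrightarrow> (\<lambda>u v. E u v \<and> v \<noteq> x)\<^sup>*\<^sup>* a b"
begin

lemma ex_other_vertex: "\<exists>v\<in>V. v \<noteq> a \<and> v \<noteq> b"
proof (rule ccontr)
  assume "\<not> ?thesis"
  then have "n \<le> card {a, b}" by (intro card_mono) auto
  also have "\<dots> \<le> 2" by (simp add: card_insert_if)
  finally show False using n_ge_3 by simp
qed

lemma ex_neighbour:
  assumes "a \<in> V" "a \<noteq> x" shows "\<exists>z. E a z \<and> z \<noteq> x"
proof -
  obtain q where q: "q \<in> V" "q \<noteq> a" "q \<noteq> x" using ex_other_vertex by blast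
  then have "(\<lambda>u v. E u v \<and> v \<noteq> x)\<^sup>*\<^sup>* a q" using two_connected assms by blast
  then show ?thesis using q by (cases rule: converse_rtranclpE) auto
qed

text \<open>A path from a neighbour of \<open>w\<close> to \<open>h\<close> avoiding
  \<open>w\<close> is closed by the pair \<open>h, w\<close>, which need only be related.\<close>

lemma ex_cycle_through:
  assumes "w \<in> V" "h \<in> V" "w \<noteq> h" "R w h"
  shows "\<exists>xs. cyc R xs \<and> w \<in> set xs \<and> h \<in> set xs"
proof -
  obtain z where z: "E w z" "z \<noteq> h" using ex_neighbour assms by blast
  have "z \<in> V - {w}" using z E_in_V2 E_irrefl by blast
  then have "(\<lambda>u v. E u v \<and> v \<noteq> w)\<^sup>*\<^sup>* z h" using two_connected assms by blast
  then obtain P where P: "P \<noteq> []" "hd P = z" "distinct P" "set P \<subseteq> V - {h} - {w}" "successively E (P @ [h])"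
    using path_to_set[of w z h "{h}"] z \<open>z \<in> V - {w}\<close> by blast
  have "successively E (w # P @ [h])" using P z by (cases P) auto
  then have "successively R (w # P @ [h])" by (rule successively_mono) (use E_R in auto)
  moreover have "3 \<le> length (w # P @ [h])" using P(1) by (cases P) auto
  ultimately have "cyc R (w # P @ [h])" unfolding cyc_def using P assms R_sym by auto
  then show ?thesis by (intro exI[of _ "w # P @ [h]"]) auto
qed

lemma heavy_in_V:
  assumes "heavy v" shows "v \<in> V"
proof -
  have "d v \<noteq> 0" using assms n_ge_3 unfolding heavy_def by auto
  then have "{u. E v u} \<noteq> {}" unfolding d_def by (metis card.empty)
  then show ?thesis using E_in_V by blast
qed

text \<open>Three or more heavy vertices, being pairwise related, form a cycle of \<open>R\<close>
  in any order. Fewer are contained in a related pair: the two heavy ones, or one vertex and a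
  neighbour of it.\<close>

lemma ex_cycle_heavy: "\<exists>xs. cyc R xs \<and> {v \<in> V. heavy v} \<subseteq> set xs"
proof -
  let ?H = "{v \<in> V. heavy v}"
  have fin: "finite ?H" using finite_V by simp
  show ?thesis
  proof (cases "3 \<le> card ?H")
    case True
    obtain xs where xs: "set xs = ?H" "distinct xs" using finite_distinct_list[OF fin] by blast
    have len: "length xs = card ?H" using xs distinct_card by metis
    have heavy: "heavy v" if "v \<in> set xs" for v using that xs by auto
    have "successively R xs" unfolding successively_conv_nth using heavy heavy_R by auto
    moreover have "R (last xs) (hd xs)"
      using True len heavy heavy_R by (metis hd_in_set last_in_set list.size(3) not_numeral_le_zero)
    ultimately have "cyc R xs" unfolding cyc_def using xs True len by auto
    then show ?thesis using xs by blast
  next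
    case False
    obtain w h where wh: "w \<in> V" "h \<in> V" "w \<noteq> h" "R w h" "?H \<subseteq> {w, h}"
    proof (cases "\<exists>w h. w \<in> ?H \<and> h \<in> ?H \<and> w \<noteq> h")
      case True
      then obtain w h where *: "w \<in> ?H" "h \<in> ?H" "w \<noteq> h" by blast
      have "?H = {w, h}"
        by (rule card_seteq[symmetric, OF fin]) (use * False in auto)
      then show thesis using that[of w h] * heavy_R by auto
    next
      case False
      obtain w where w: "w \<in> V" "?H \<subseteq> {w}"
      proof (cases "?H = {}")
        case True
        then show thesis using that ex_other_vertex by blast
      next
        case False
        then show thesis using that \<open>\<not> (\<exists>w h. w \<in> ?H \<and> h \<in> ?H \<and> w \<noteq> h)\<close> by blast
      qed
      obtain q where "q \<in> V" "q \<noteq> w" using ex_other_vertex by blast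
      then obtain h where h: "E w h" using ex_neighbour[of w q] w by blast
      then show thesis using that[of w h] w E_in_V2 E_irrefl E_R by blast
    qed
    obtain xs where "cyc R xs" "w \<in> set xs" "h \<in> set xs" using ex_cycle_through[OF wh(1-4)] by blast
    moreover have "?H \<subseteq> set xs" using wh(5) calculation(2,3) by auto
    ultimately show ?thesis by blast
  qed
qed

text \<open>Some edge leaves \<open>S\<close>, say from \<open>x\<close> to \<open>w\<close>;
  deleting \<open>x\<close> still leaves a path from \<open>w\<close> back to \<open>S\<close>,
  which ends at another vertex.\<close>

lemma ex_link:
  assumes "S \<subseteq> V" "S \<noteq> V" "2 \<le> card S"
  shows "\<exists>x y P. x \<in> S \<and> y \<in> S \<and> x \<noteq> y \<and> P \<noteq> [] \<and> distinct P \<and> set P \<subseteq> V - S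
    \<and> successively E (x # P @ [y])"
proof -
  obtain b where b: "b \<in> V" "b \<notin> S" using assms by blast
  obtain a where a: "a \<in> S" using assms(3) by (metis card.empty ex_in_conv not_numeral_le_zero)
  \<comment> \<open>Reachability is available only with a vertex deleted; \<open>q\<close> is an
    arbitrary third vertex to delete.\<close>
  obtain q where q: "q \<in> V" "q \<noteq> a" "q \<noteq> b" using ex_other_vertex by blast
  have "(\<lambda>u v. E u v \<and> v \<noteq> q)\<^sup>*\<^sup>* a b" by (rule two_connected) (use a b q assms in auto)
  then have "\<exists>x w. x \<in> S \<and> w \<notin> S \<and> E x w" using a b(2)
    by (induction rule: converse_rtranclp_induct) blast+
  then obtain x w where xw: "x \<in> S" "w \<notin> S" "E x w" by blast
  have "\<not> S \<subseteq> {x}" using assms(3) card_mono[of "{x}" S] by auto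
  then obtain t where t: "t \<in> S" "t \<noteq> x" by blast
  have wV: "w \<in> V - S - {x}" using xw E_in_V2 by blast
  have "(\<lambda>u v. E u v \<and> v \<noteq> x)\<^sup>*\<^sup>* w t" by (rule two_connected) (use wV t assms in auto)
  then obtain P y where P: "P \<noteq> []" "hd P = w" "distinct P" "set P \<subseteq> V - S - {x}" "successively E (P @ [y])"
    "y \<in> S" "y \<noteq> x" using path_to_set[OF _ wV t(1)] by blast
  have "successively E (x # P @ [y])" using P xw by (cases P) auto
  then show ?thesis using P xw by (intro exI[of _ x] exI[of _ y] exI[of _ P]) auto
qed

lemma ex_spanning_cycle:
  assumes claw: "\<And>c x y z. \<lbrakk>E c x; E c y; E c z; x \<noteq> y; x \<noteq> z; y \<noteq> z; \<not> E x y; \<not> E x z; \<not> E y z\<rbrakk>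
      \<Longrightarrow> R x y \<or> R x z \<or> R y z"
    and Z2: "\<And>a1 a2 a3 b c. \<lbrakk>E a1 a2; E a1 a3; E a2 a3; E a1 b; E b c;
        \<not> E a1 c; \<not> E a2 b; \<not> E a2 c; \<not> E a3 b; \<not> E a3 c\<rbrakk>
      \<Longrightarrow> heavy a2 \<or> heavy b \<or> (\<exists>z. z \<noteq> a1 \<and> E a2 z \<and> E b z)"
  shows "\<exists>xs. cyc E xs \<and> set xs = V"
proof -
  let ?P = "\<lambda>xs. cyc R xs \<and> {v. heavy v} \<subseteq> set xs"
  obtain xs0 where "?P xs0" using ex_cycle_heavy heavy_in_V by blast
  moreover have "\<forall>xs. ?P xs \<longrightarrow> card (set xs) < Suc n"
    using finite_V card_mono unfolding cyc_def by (metis le_imp_less_Suc)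
  \<comment> \<open>A cycle of \<open>R\<close> through all of \<open>set xs\<close> also contains
    the heavy vertices, so maximal cardinality implies maximality under inclusion.\<close>
  ultimately obtain xs where xs: "?P xs" and max: "\<And>ys. ?P ys \<Longrightarrow> card (set ys) \<le> card (set xs)"
    using ex_has_greatest_nat[of ?P xs0 "\<lambda>xs. card (set xs)" "Suc n"] by blast
  interpret maximal_cycle_Z2 V E "set xs"
  proof unfold_locales
    fix ys assume "cyc R ys" "set xs \<subseteq> set ys"
    then show "set ys \<subseteq> set xs" using max[of ys] xs card_seteq[of "set ys" "set xs"] by auto
  next
    fix v assume "heavy v"
    then show "v \<in> set xs" using xs by blast
  qed (fact claw, fact Z2)
  obtain C where C: "cyc E C" "set C = set xs" using ex_E_cycle xs by blast
  have "set C = V"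
  proof (rule ccontr)
    assume "set C \<noteq> V"
    moreover have "set C \<subseteq> V" "2 \<le> card (set C)" using C(1) distinct_card[of C] unfolding cyc_def by auto
    ultimately obtain x y P where P: "x \<in> set C" "y \<in> set C" "x \<noteq> y" "P \<noteq> []" "distinct P"
        "set P \<subseteq> V - set C" "successively E (x # P @ [y])"
      using ex_link[of "set C"] by blast
    obtain us vs where "C = us @ x # vs" using P(1) by (meson split_list)
    then have 1: "cyc E (x # vs @ us)" "set (x # vs @ us) = set xs"
      using cyc_rotate[of E us "x # vs"] C by auto
    then obtain A B where "vs @ us = A @ y # B" using P(2,3) C by (metis set_ConsD split_list)
    then show False using no_link[of x A y B P] 1 P C unfolding link_def by auto
  qed
  then show ?thesis using C by blast
qed

end

section \<open>Translation between symmetric digraphs and the adjacency relation\<close>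

context graph
begin

lemma adjacent_induce_iff: "u \<rightarrow>\<^bsub>G \<restriction> W\<^esub> v \<longleftrightarrow> u \<in> W \<and> v \<in> W \<and> u \<rightarrow> v"
  by (auto simp: arcs_ends_conv)

lemma arcs_ends_induce:
  "arcs_ends (G \<restriction> W) = (\<Union>u\<in>W. \<Union>v\<in>W. if u \<rightarrow> v then {(u, v)} else {})"
  by (auto simp: adjacent_induce_iff split: if_splits)

lemma deg_eq_card_neighborhood: "deg G v = card (neighborhood G v)"
proof -
  have "neighborhood G v = head G ` out_arcs G v"
    unfolding neighborhood_def out_arcs_def by (auto simp: arcs_ends_conv)
  moreover have "inj_on (head G) (out_arcs G v)"
    unfolding out_arcs_def by (rule inj_onI) (auto intro: no_multi_arcs simp: arc_to_ends_def)
  ultimately show ?thesis unfolding out_degree_def by (simp add: card_image)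
qed

text \<open>The tails are recorded because \<open>hamiltonian\<close> reads the vertices of a cycle
  off them; the final vertex is the tail of no new arc, hence \<open>butlast\<close>.\<close>

lemma awalk_of_vertices:
  assumes "zs \<noteq> []" "successively (\<lambda>u v. u \<rightarrow> v) zs"
  shows "\<exists>p. set p \<subseteq> arcs G \<and> cas (hd zs) p (last zs) \<and> awalk_verts (hd zs) p = zs
    \<and> map (tail G) p = butlast zs"
  using assms
proof (induction zs rule: induct_list012)
  case (3 x y zs)
  then obtain p where p: "set p \<subseteq> arcs G" "cas y p (last (y # zs))" "awalk_verts y p = y # zs"
    "map (tail G) p = butlast (y # zs)" by auto
  from 3 obtain e where "e \<in> arcs G" "tail G e = x" "head G e = y" by (auto simp: arcs_ends_conv)
  then show ?case using p by (intro exI[of _ "e # p"]) auto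
qed auto

lemma hamiltonian_of_vertices:
  assumes "3 \<le> length xs" "distinct xs" "set xs = verts G"
    and "successively (\<lambda>u v. u \<rightarrow> v) xs" "last xs \<rightarrow> hd xs"
  shows "hamiltonian G"
proof -
  obtain x ys where xs: "xs = x # ys" using assms(1) by (cases xs) auto
  have "successively (\<lambda>u v. u \<rightarrow> v) (xs @ [x])"
    using assms(4,5) xs unfolding successively_append_iff by auto
  then have "\<exists>p. set p \<subseteq> arcs G \<and> cas x p x \<and> awalk_verts x p = xs @ [x] \<and> map (tail G) p = xs"
    using awalk_of_vertices[of "xs @ [x]"] xs by simp
  then obtain p where p: "set p \<subseteq> arcs G" "cas x p x" "awalk_verts x p = xs @ [x]" "map (tail G) p = xs"
    by blast
  have "length p = length xs" "tail G ` set p = set xs" using p(4) by (metis length_map, metis set_map)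
  moreover have "cycle p"
    unfolding cycle_def awalk_def using p assms xs by (intro exI[of _ x]) auto
  ultimately show ?thesis unfolding hamiltonian_def using assms by auto
qed

lemma two_connected_avoiding:
  assumes "k_connected 2 G" "a \<in> verts G - {x}" "b \<in> verts G - {x}"
  shows "(\<lambda>u v. u \<rightarrow> v \<and> v \<noteq> x)\<^sup>*\<^sup>* a b"
proof -
  \<comment> \<open>The deleted set is \<open>{x} \<inter> verts G\<close>, since
    \<open>k_connected\<close> deletes only subsets of \<open>verts G\<close> and \<open>x\<close>
    is arbitrary.\<close>
  let ?W = "verts G - {x} \<inter> verts G"
  have "connected (G \<restriction> ?W)"
    using assms(1) card_mono[of "{x}" "{x} \<inter> verts G"] unfolding k_connected_def by auto
  then have "(a, b) \<in> rtrancl_on ?W (parcs (mk_symmetric (G \<restriction> ?W)))"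
    using assms(2,3) unfolding connected_def strongly_connected_def reachable_def by auto
  then show ?thesis
  proof (induction rule: rtrancl_on_induct)
    case (step u v)
    then have "u \<rightarrow>\<^bsub>G \<restriction> ?W\<^esub> v \<or> v \<rightarrow>\<^bsub>G \<restriction> ?W\<^esub> u"
      unfolding parcs_mk_symmetric arcs_ends_conv by blast
    then have "u \<rightarrow> v \<and> v \<noteq> x"
      unfolding adjacent_induce_iff using graph_symmetric by blast
    then show ?case using step by (simp add: rtranclp.rtrancl_into_rtrancl)
  qed simp
qed

end

theorem theorem10:
  fixes G :: "('a, 'b) pre_digraph" and n :: nat
  assumes "graph G"
    and "n = card (verts G)"
    and "n \<ge> 3"
    and "k_connected 2 G"
    and "o_heavy G"
    and "\<And>a1 a2 a3 b1 c1 u v.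
           induced_Z2 G a1 a2 a3 b1 c1 \<Longrightarrow> (u, v) \<in> {(a2, b1), (a3, b1)} \<Longrightarrow>
             real (max (deg G u) (deg G v)) \<ge> real n / 2 \<or>
             card (neighborhood G u \<inter> neighborhood G v) \<ge> 2"
  shows "hamiltonian G"
proof -
  interpret graph G by fact
  let ?E = "\<lambda>u v. u \<rightarrow>\<^bsub>G\<^esub> v"
  have sym: "v \<rightarrow>\<^bsub>G\<^esub> u" if "u \<rightarrow>\<^bsub>G\<^esub> v" for u v using that by (rule graph_symmetric)
  have irrefl: "\<not> u \<rightarrow>\<^bsub>G\<^esub> u" for u using adj_not_same by blast
  interpret two_connected_graph "verts G" ?E
    by unfold_locales
      (use assms sym irrefl two_connected_avoiding in \<open>auto simp: adj_in_verts\<close>)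
  have d: "d v = deg G v" for v
    unfolding d_def deg_eq_card_neighborhood neighborhood_def by simp
  have "\<exists>xs. cyc ?E xs \<and> set xs = verts G"
  proof (rule ex_spanning_cycle)
    fix c x y z
    assume E: "c \<rightarrow>\<^bsub>G\<^esub> x" "c \<rightarrow>\<^bsub>G\<^esub> y" "c \<rightarrow>\<^bsub>G\<^esub> z" and ne: "x \<noteq> y" "x \<noteq> z" "y \<noteq> z"
      and N: "\<not> x \<rightarrow>\<^bsub>G\<^esub> y" "\<not> x \<rightarrow>\<^bsub>G\<^esub> z" "\<not> y \<rightarrow>\<^bsub>G\<^esub> z"
    have N': "\<not> y \<rightarrow>\<^bsub>G\<^esub> x" "\<not> z \<rightarrow>\<^bsub>G\<^esub> x" "\<not> z \<rightarrow>\<^bsub>G\<^esub> y" using N sym by blast+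
    have "c \<noteq> x" "c \<noteq> y" "c \<noteq> z" using E irrefl by blast+
    moreover have "arcs_ends (G \<restriction> {c, x, y, z}) = {(c, x), (c, y), (c, z)}\<^sup>s"
      unfolding symcl_def by (simp add: arcs_ends_induce E sym[OF E(1)] sym[OF E(2)] sym[OF E(3)] N N' irrefl) blast
    ultimately have "induced_claw G c x y z"
      unfolding induced_claw_def using E ne adj_in_verts by auto
    then have "\<exists>u\<in>{x, y, z}. \<exists>v\<in>{x, y, z}. u \<noteq> v \<and> card (verts G) \<le> deg G u + deg G v"
      using assms(5) unfolding o_heavy_def by simp
    then show "R x y \<or> R x z \<or> R y z" unfolding R_def d by (auto simp: add.commute)
  next
    fix a1 a2 a3 b c
    assume E: "a1 \<rightarrow>\<^bsub>G\<^esub> a2" "a1 \<rightarrow>\<^bsub>G\<^esub> a3" "a2 \<rightarrow>\<^bsub>G\<^esub> a3" "a1 \<rightarrow>\<^bsub>G\<^esub> b" "b \<rightarrow>\<^bsub>G\<^esub> c"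
      and N: "\<not> a1 \<rightarrow>\<^bsub>G\<^esub> c" "\<not> a2 \<rightarrow>\<^bsub>G\<^esub> b" "\<not> a2 \<rightarrow>\<^bsub>G\<^esub> c" "\<not> a3 \<rightarrow>\<^bsub>G\<^esub> b" "\<not> a3 \<rightarrow>\<^bsub>G\<^esub> c"
    have E': "a2 \<rightarrow>\<^bsub>G\<^esub> a1" "a3 \<rightarrow>\<^bsub>G\<^esub> a1" "a3 \<rightarrow>\<^bsub>G\<^esub> a2" "b \<rightarrow>\<^bsub>G\<^esub> a1" "c \<rightarrow>\<^bsub>G\<^esub> b" using E sym by blast+
    have N': "\<not> c \<rightarrow>\<^bsub>G\<^esub> a1" "\<not> b \<rightarrow>\<^bsub>G\<^esub> a2" "\<not> c \<rightarrow>\<^bsub>G\<^esub> a2" "\<not> b \<rightarrow>\<^bsub>G\<^esub> a3" "\<not> c \<rightarrow>\<^bsub>G\<^esub> a3" using N sym by blast+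
    \<comment> \<open>Adjacent vertices differ by irreflexivity; each nonadjacent pair is separated
      by a third vertex adjacent to exactly one of the two.\<close>
    have "distinct [a1, a2, a3, b, c]" using E E' N N' irrefl by auto
    moreover have "arcs_ends (G \<restriction> {a1, a2, a3, b, c}) =
        {(a1, a2), (a1, a3), (a2, a3), (a1, b), (b, c)}\<^sup>s"
      unfolding symcl_def by (simp add: arcs_ends_induce E E' N N' irrefl) blast
    ultimately have "induced_Z2 G a1 a2 a3 b c"
      unfolding induced_Z2_def using E adj_in_verts by auto
    then consider "real (max (deg G a2) (deg G b)) \<ge> real n / 2"
      | "card (neighborhood G a2 \<inter> neighborhood G b) \<ge> 2"
      using assms(6)[of a1 a2 a3 b c a2 b] by auto
    then show "heavy a2 \<or> heavy b \<or> (\<exists>z. z \<noteq> a1 \<and> a2 \<rightarrow>\<^bsub>G\<^esub> z \<and> b \<rightarrow>\<^bsub>G\<^esub> z)"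
    proof cases
      case 1
      then show ?thesis unfolding heavy_def d assms(2)[symmetric] by (auto simp: max_def split: if_splits)
    next
      case 2
      \<comment> \<open>\<open>a1\<close> is one common neighbour, so having two provides
        another.\<close>
      then have "\<not> neighborhood G a2 \<inter> neighborhood G b \<subseteq> {a1}"
        using card_mono[of "{a1}" "neighborhood G a2 \<inter> neighborhood G b"] by auto
      then show ?thesis unfolding neighborhood_def by auto
    qed
  qed
  then show ?thesis
    using hamiltonian_of_vertices unfolding cyc_def by blast
qed

end
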